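(* Let $A\in\mathbb{C}^{2\times2}$ be a non-singular matrix with $A=VCV^{-1}$, where $$C=\begin{pmatrix}a_+&0\\ 1&a_+\end{pmatrix},\qquad V=\begin{pmatrix}v_1&v_2\\ v_3&v_4\end{pmatrix}.$$ For $\lambda\in\mathbb{C}$ put $$B_\lambda=\begin{pmatrix}0&I\\ -\lambda^2C^{-1}&0\end{pmatrix}\in\mathbb{C}^{4\times4},\qquad \Psi=\begin{pmatrix}v_1&v_2&0&0\\ 0&0&v_3&v_4\end{pmatrix}\in\mathbb{C}^{2\times4}.$$ Then $\lambda$ is an eigenvalue of the system $\Phi'=B_\lambda\Phi$ on $[0,1]$, $\Psi\Phi(0)=\Psi\Phi(1)=0$, if and only if $EV(\lambda)=0$, where $$EV(x)=\left(\frac{v_2^2v_4^2}{4a_+^3}\right)x^2-\left(\det V+\frac{v_2v_4}{2a_+}\right)^2\sin^2\frac{x}{\sqrt{a_+}}.$$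
   Context: $\lambda\in\mathbb{C}$ is called an eigenvalue of the system if there exists a smooth function $\Phi:[0,1]\to\mathbb{C}^4$, not identically zero, with $\Phi'(x)=B_\lambda\Phi(x)$ and $\Psi\Phi(0)=\Psi\Phi(1)=0$. Here $\sqrt{a_+}$ denotes a fixed choice of complex square root. (The system is the first-order form, via $\Phi=(g,g')$ and $f=Vg$, of the problem $-Af''=\lambda^2f$ for $f=\begin{pmatrix}\phi\\ \gamma\end{pmatrix}$ with $\phi(0)=\phi(1)=0$, $\gamma'(0)=\gamma'(1)=0$.) *)

theory Defs
  imports "HOL-Analysis.Analysis"
begin

(* C-infinity on a set S of reals, with all derivatives taken within S
   (so one-sided at the end points of a compact interval);
   D n is the n-th derivative of f. *)
definition smooth_on :: "real set \<Rightarrow> (real \<Rightarrow> 'a::real_normed_vector) \<Rightarrow> bool" where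
  "smooth_on S f \<longleftrightarrow>
     (\<exists>D :: nat \<Rightarrow> real \<Rightarrow> 'a.
        (\<forall>x\<in>S. D 0 x = f x) \<and>
        (\<forall>n. \<forall>x\<in>S. (D n has_vector_derivative D (Suc n) x) (at x within S)))"

definition block_mat :: "'a::zero^2^2 \<Rightarrow> 'a^2^2 \<Rightarrow> 'a^2^2 \<Rightarrow> 'a^2^2 \<Rightarrow> 'a^4^4" where
  "block_mat P Q R S = vector
     [vector [P$1$1, P$1$2, Q$1$1, Q$1$2],
      vector [P$2$1, P$2$2, Q$2$1, Q$2$2],
      vector [R$1$1, R$1$2, S$1$1, S$1$2],
      vector [R$2$1, R$2$2, S$2$1, S$2$2]]"

definition B_mat :: "complex^2^2 \<Rightarrow> complex \<Rightarrow> complex^4^4" where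
  "B_mat C lam = block_mat 0 (mat 1) (- mat (lam^2) ** matrix_inv C) 0"

definition Psi_mat :: "complex^2^2 \<Rightarrow> complex^4^2" where
  "Psi_mat V = vector
     [vector [V$1$1, V$1$2, 0, 0],
      vector [0, 0, V$2$1, V$2$2]]"

definition system_eigenvalue ::
    "(complex \<Rightarrow> complex^4^4) \<Rightarrow> complex^4^2 \<Rightarrow> complex \<Rightarrow> bool" where
  "system_eigenvalue B Psi lam \<longleftrightarrow>
     (\<exists>Phi :: real \<Rightarrow> complex^4.
        smooth_on {0..1} Phi \<and>
        (\<exists>x\<in>{0..1}. Phi x \<noteq> 0) \<and>
        (\<forall>x\<in>{0..1}. (Phi has_vector_derivative B lam *v Phi x) (at x within {0..1})) \<and>
        Psi *v Phi 0 = 0 \<and> Psi *v Phi 1 = 0)"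

(* The argument s stands for the chosen complex square root of a. *)
definition EV :: "complex^2^2 \<Rightarrow> complex \<Rightarrow> complex \<Rightarrow> complex \<Rightarrow> complex" where
  "EV V a s x =
     ((V$1$2)^2 * (V$2$2)^2 / (4 * a^3)) * x^2
       - (det V + V$1$2 * V$2$2 / (2 * a))^2 * (sin (x / s))^2"

end

theory Submission
  imports Defs
begin

text \<open>
  For \<open>lam = 0\<close> the constant function \<open>(v2, -v1, 0, 0)\<close> is an eigenfunction and \<open>EV\<close> vanishes.
  For \<open>lam \<noteq> 0\<close> put \<open>w = lam / s\<close> and \<open>h = 1 / (2 * a)\<close>. Along a solution
  \<open>(p1, p2, q1, q2)\<close> both \<open>(p1, q1)\<close> and \<open>(p2 + h x q1, q2 + h q1 - h w\<^sup>2 x p1)\<close> are harmonic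
  oscillators of frequency \<open>w\<close>, so the flow is explicit. The condition at 0 says that
  \<open>(p1, p2) = m (v2, -v1)\<close> and \<open>(q1, q2) = w n (v4, -v3)\<close> there, and the condition at 1 is then
  a homogeneous linear system for \<open>(m, n)\<close> with determinant \<open>EV\<close>.
\<close>

section \<open>Componentwise differentiation and smoothness of linear flows\<close>

lemma vector_4:
  "(vector [x, y, z, t] :: 'a::zero^4) $ 1 = x"
  "(vector [x, y, z, t] :: 'a::zero^4) $ 2 = y"
  "(vector [x, y, z, t] :: 'a::zero^4) $ 3 = z"
  "(vector [x, y, z, t] :: 'a::zero^4) $ 4 = t"
  unfolding vector_def by simp_all

lemma has_vector_derivative_vec_iff:
  fixes f :: "real \<Rightarrow> 'a::real_normed_vector^'n"
  shows "(f has_vector_derivative D) (at x within S) \<longleftrightarrow>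
    (\<forall>i. ((\<lambda>x. f x $ i) has_vector_derivative D $ i) (at x within S))"
proof
  assume "(f has_vector_derivative D) (at x within S)"
  then show "\<forall>i. ((\<lambda>x. f x $ i) has_vector_derivative D $ i) (at x within S)"
    using bounded_linear.has_vector_derivative[OF bounded_linear_vec_nth] by blast
next
  assume "\<forall>i. ((\<lambda>x. f x $ i) has_vector_derivative D $ i) (at x within S)"
  then show "(f has_vector_derivative D) (at x within S)"
    unfolding has_vector_derivative_def has_derivative_within
    by (auto intro!: vec_tendstoI bounded_linear_scaleR_left)
qed

lemma has_vector_derivative_matrix_vector_mult:
  fixes M :: "'a::real_normed_field^'n^'m"
  assumes "(f has_vector_derivative D) (at x within S)"
  shows "((\<lambda>x. M *v f x) has_vector_derivative M *v D) (at x within S)"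
  unfolding has_vector_derivative_vec_iff matrix_vector_mult_def
  using assms[unfolded has_vector_derivative_vec_iff]
  by (auto intro!: has_vector_derivative_sum has_vector_derivative_mult_right)

lemma smooth_on_linear_ode:
  fixes M :: "'a::real_normed_field^'n^'n"
  assumes "\<And>x. x \<in> S \<Longrightarrow> (f has_vector_derivative M *v f x) (at x within S)"
  shows "smooth_on S f"
  unfolding smooth_on_def
proof (intro exI conjI ballI allI)
  fix n x assume x: "x \<in> S"
  show "((\<lambda>x. (((*v) M) ^^ n) (f x)) has_vector_derivative (((*v) M) ^^ Suc n) (f x)) (at x within S)"
  proof (induction n)
    case 0
    then show ?case using assms[OF x] by simp
  next
    case (Suc n)
    from has_vector_derivative_matrix_vector_mult[OF this, of M] show ?case by simp
  qed
qed simp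

text \<open>Smoothness is automatic for solutions of a linear system with constant coefficients, so
  only the differential equation and the boundary conditions remain to be studied.\<close>

lemma system_eigenvalue_iff:
  "system_eigenvalue B Psi lam \<longleftrightarrow>
    (\<exists>Phi. (\<exists>x\<in>{0..1}. Phi x \<noteq> 0) \<and>
      (\<forall>x\<in>{0..1}. (Phi has_vector_derivative B lam *v Phi x) (at x within {0..1})) \<and>
      Psi *v Phi 0 = 0 \<and> Psi *v Phi 1 = 0)"
  unfolding system_eigenvalue_def using smooth_on_linear_ode by blast

section \<open>The Jordan-block system in coordinates and its flow\<close>

lemma matrix_inv_eqI:
  fixes M N :: "'a::field^'n^'n"
  assumes "M ** N = mat 1"
  shows "matrix_inv M = N"
proof -
  have "N ** M = mat 1" using assms matrix_left_right_inverse by blast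
  then have "M ** matrix_inv M = mat 1 \<and> matrix_inv M ** M = mat 1"
    unfolding matrix_inv_def using assms by (metis (mono_tags, lifting) someI_ex)
  then show ?thesis
    by (metis \<open>N ** M = mat 1\<close> matrix_mul_assoc matrix_mul_lid matrix_mul_rid)
qed

lemma matrix_inv_jordan_block:
  fixes a :: "'a::field"
  assumes "a \<noteq> 0"
  shows "matrix_inv (vector [vector [a, 0], vector [1, a]] :: 'a^2^2) =
    vector [vector [1 / a, 0], vector [- 1 / a^2, 1 / a]]"
  by (rule matrix_inv_eqI)
    (use assms in \<open>simp add: vec_eq_iff forall_2 matrix_matrix_mult_def sum_2 mat_def field_simps power2_eq_square\<close>)

text \<open>This is multiplication by the system matrix, with \<open>w^2\<close> for
  \<open>lam^2 / a\<close> and \<open>2 * h * w^2\<close> for \<open>lam^2 / a^2\<close>.\<close>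

definition jordan_field :: "complex \<Rightarrow> complex \<Rightarrow> complex^4 \<Rightarrow> complex^4" where
  "jordan_field w h y =
     vector [y$3, y$4, - (w^2) * y$1, 2 * h * w^2 * y$1 - w^2 * y$2]"

lemma B_mat_jordan_block:
  assumes "a \<noteq> 0" "s^2 = a"
  shows "B_mat (vector [vector [a, 0], vector [1, a]]) lam *v y =
    jordan_field (lam / s) (1 / (2 * a)) y"
  using assms
  by (simp add: B_mat_def block_mat_def matrix_inv_jordan_block jordan_field_def vec_eq_iff
      forall_4 matrix_vector_mult_def sum_4 vector_4 mat_def matrix_matrix_mult_def sum_2
      power_divide field_simps power2_eq_square)

lemma Psi_mat_mult_eq_0_iff:
  "Psi_mat V *v y = 0 \<longleftrightarrow>
    V$1$1 * y$1 + V$1$2 * y$2 = 0 \<and> V$2$1 * y$3 + V$2$2 * y$4 = 0"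
  by (simp add: Psi_mat_def vec_eq_iff forall_2 matrix_vector_mult_def sum_4 vector_4)

text \<open>The pairs \<open>(p, q)\<close> and \<open>(r, u)\<close> are the two decoupled
  oscillators, started at \<open>(y$1, y$3)\<close> and \<open>(y$2, y$4 + h * y$3)\<close>; the
  final vector undoes the decoupling substitution. Time is complex so that the rules for complex
  derivatives apply.\<close>

definition jordan_flow :: "complex \<Rightarrow> complex \<Rightarrow> complex^4 \<Rightarrow> complex \<Rightarrow> complex^4" where
  "jordan_flow w h y x =
    (let p = y$1 * cos (w * x) + y$3 / w * sin (w * x);
         q = - w * y$1 * sin (w * x) + y$3 * cos (w * x);
         r = y$2 * cos (w * x) + (y$4 + h * y$3) / w * sin (w * x);
         u = - w * y$2 * sin (w * x) + (y$4 + h * y$3) * cos (w * x)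
     in vector [p, r - h * x * q, q, u - h * q + h * w^2 * x * p])"

lemma jordan_flow_0: "jordan_flow w h y 0 = y"
  by (simp add: jordan_flow_def vec_eq_iff forall_4 vector_4)

lemma jordan_flow_has_vector_derivative:
  assumes "w \<noteq> 0"
  shows "((\<lambda>x. jordan_flow w h y (of_real x)) has_vector_derivative
    jordan_field w h (jordan_flow w h y (of_real x))) (at x within S)"
  unfolding has_vector_derivative_vec_iff forall_4
  by (intro conjI; rule has_vector_derivative_real_field; simp add: jordan_flow_def jordan_field_def vector_4 Let_def)
    (rule derivative_eq_intros refl assms | use assms in \<open>simp add: field_simps power2_eq_square\<close>)+

text \<open>Rotating \<open>(w * p, q)\<close> back through the angle \<open>w * x\<close> yields
  two quantities with zero derivative. They keep their values at 0, and
  \<open>cos^2 + sin^2 = 1\<close> inverts the rotation.\<close>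

lemma oscillator_unique:
  fixes p q :: "real \<Rightarrow> complex"
  assumes w: "w \<noteq> 0"
    and S: "convex S" "0 \<in> S" "x \<in> S"
    and p: "\<And>x. x \<in> S \<Longrightarrow> (p has_vector_derivative q x) (at x within S)"
    and q: "\<And>x. x \<in> S \<Longrightarrow> (q has_vector_derivative - (w^2) * p x) (at x within S)"
  shows "p x = p 0 * cos (w * of_real x) + q 0 / w * sin (w * of_real x)"
    and "q x = - w * p 0 * sin (w * of_real x) + q 0 * cos (w * of_real x)"
proof -
  have c: "((\<lambda>x. cos (w * of_real x)) has_vector_derivative - w * sin (w * of_real x)) (at x within S)" for x
    by (rule has_vector_derivative_real_field) (auto intro!: derivative_eq_intros)
  have s: "((\<lambda>x. sin (w * of_real x)) has_vector_derivative w * cos (w * of_real x)) (at x within S)" for x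
    by (rule has_vector_derivative_real_field) (auto intro!: derivative_eq_intros)
  have "((\<lambda>x. w * (p x * cos (w * of_real x)) - q x * sin (w * of_real x)) has_vector_derivative 0) (at x within S)"
    if "x \<in> S" for x
    by (rule derivative_eq_intros p q c s that refl has_vector_derivative_mult_right)+
      (simp add: algebra_simps power2_eq_square)
  then have 1: "w * (p x * cos (w * of_real x)) - q x * sin (w * of_real x) = w * p 0"
    using has_vector_derivative_zero_constant[OF S(1)] S(2,3)
    by (smt (verit) cos_zero mult_zero_right of_real_0 sin_zero diff_zero mult.right_neutral)
  have "((\<lambda>x. w * (p x * sin (w * of_real x)) + q x * cos (w * of_real x)) has_vector_derivative 0) (at x within S)"
    if "x \<in> S" for x
    by (rule derivative_eq_intros p q c s that refl has_vector_derivative_mult_right)+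
      (simp add: algebra_simps power2_eq_square)
  then have 2: "w * (p x * sin (w * of_real x)) + q x * cos (w * of_real x) = q 0"
    using has_vector_derivative_zero_constant[OF S(1)] S(2,3)
    by (smt (verit) cos_zero mult_zero_right of_real_0 sin_zero add_0 mult.right_neutral)
  have 3: "cos (w * of_real x) ^ 2 + sin (w * of_real x) ^ 2 = 1" by simp
  have "w * p x = w * p 0 * cos (w * of_real x) + q 0 * sin (w * of_real x)"
    using 1 2 3 by algebra
  then show "p x = p 0 * cos (w * of_real x) + q 0 / w * sin (w * of_real x)"
    using w by (simp add: field_simps)
  show "q x = - w * p 0 * sin (w * of_real x) + q 0 * cos (w * of_real x)"
    using 1 2 3 by algebra
qed

lemma jordan_flow_unique:
  fixes f :: "real \<Rightarrow> complex^4"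
  assumes w: "w \<noteq> 0"
    and S: "convex S" "0 \<in> S" "x \<in> S"
    and f: "\<And>x. x \<in> S \<Longrightarrow> (f has_vector_derivative jordan_field w h (f x)) (at x within S)"
  shows "f x = jordan_flow w h (f 0) (of_real x)"
proof -
  have d: "((\<lambda>x. f x $ 1) has_vector_derivative f x $ 3) (at x within S)"
     "((\<lambda>x. f x $ 2) has_vector_derivative f x $ 4) (at x within S)"
     "((\<lambda>x. f x $ 3) has_vector_derivative - (w^2) * f x $ 1) (at x within S)"
     "((\<lambda>x. f x $ 4) has_vector_derivative 2 * h * w^2 * f x $ 1 - w^2 * f x $ 2) (at x within S)"
    if "x \<in> S" for x
    using f[OF that] unfolding has_vector_derivative_vec_iff forall_4
    by (simp_all add: jordan_field_def vector_4)
  have i: "((\<lambda>x. of_real x :: complex) has_vector_derivative 1) (at x within S)" for x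
    using has_vector_derivative_real_field[OF DERIV_ident] .
  \<comment> \<open>The terms linear in \<open>x\<close> absorb the resonant forcing
    \<open>2 * h * w^2 * f x $ 1\<close>, so \<open>r\<close> and \<open>u\<close> satisfy an
    unforced oscillator equation.\<close>
  define r where "r x = f x $ 2 + h * (of_real x * f x $ 3)" for x
  define u where "u x = f x $ 4 + h * f x $ 3 - h * w^2 * (of_real x * f x $ 1)" for x
  have r: "(r has_vector_derivative u x) (at x within S)" if "x \<in> S" for x
    unfolding r_def[abs_def] u_def
    by (rule derivative_eq_intros d i that refl has_vector_derivative_mult_right)+
      (simp add: algebra_simps)
  have u: "(u has_vector_derivative - (w^2) * r x) (at x within S)" if "x \<in> S" for x
    unfolding r_def u_def[abs_def]
    by (rule derivative_eq_intros d i that refl has_vector_derivative_mult_right)+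
      (simp add: algebra_simps)
  note pq = oscillator_unique[OF w S d(1,3)]
  note ru = oscillator_unique[OF w S r u]
  have "f x $ 2 = r x - h * of_real x * f x $ 3"
    "f x $ 4 = u x - h * f x $ 3 + h * w^2 * of_real x * f x $ 1"
    by (simp_all add: r_def u_def)
  moreover have "r 0 = f 0 $ 2" "u 0 = f 0 $ 4 + h * f 0 $ 3"
    by (simp_all add: r_def u_def)
  ultimately show ?thesis
    using pq ru by (simp add: jordan_flow_def Let_def vec_eq_iff forall_4 vector_4)
qed

section \<open>Linear equations in two unknowns\<close>

lemma linear_form_kernel_2:
  fixes a b x y :: "'a::field"
  assumes "a \<noteq> 0 \<or> b \<noteq> 0"
  shows "a * x + b * y = 0 \<longleftrightarrow> (\<exists>m. x = m * b \<and> y = - m * a)"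
proof
  assume *: "a * x + b * y = 0"
  show "\<exists>m. x = m * b \<and> y = - m * a"
  proof (cases "b = 0")
    case True
    with * assms show ?thesis by (intro exI[of _ "- y / a"]) auto
  next
    case False
    with * show ?thesis
      by (intro exI[of _ "x / b"]) (simp add: field_simps eq_neg_iff_add_eq_0)
  qed
qed auto

text \<open>Elimination shows that the determinant kills both unknowns. Conversely, a nonzero row
  rotated by a right angle solves both equations, and if both rows vanish any vector does.\<close>

lemma homogeneous_system_2:
  fixes a b c d :: "'a::field"
  shows "(\<exists>x y. (x \<noteq> 0 \<or> y \<noteq> 0) \<and> a * x + b * y = 0 \<and> c * x + d * y = 0) \<longleftrightarrow> a * d - b * c = 0"
proof
  assume "\<exists>x y. (x \<noteq> 0 \<or> y \<noteq> 0) \<and> a * x + b * y = 0 \<and> c * x + d * y = 0"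
  then obtain x y where xy: "x \<noteq> 0 \<or> y \<noteq> 0" "a * x + b * y = 0" "c * x + d * y = 0" by blast
  have "(a * d - b * c) * x = 0" "(a * d - b * c) * y = 0"
    using xy(2,3) by algebra+
  with xy(1) show "a * d - b * c = 0" by auto
next
  assume *: "a * d - b * c = 0"
  show "\<exists>x y. (x \<noteq> 0 \<or> y \<noteq> 0) \<and> a * x + b * y = 0 \<and> c * x + d * y = 0"
  proof (cases "a = 0 \<and> b = 0")
    case True
    show ?thesis
    proof (cases "c = 0 \<and> d = 0")
      case True
      with \<open>a = 0 \<and> b = 0\<close> show ?thesis by (intro exI[of _ 1]) auto
    next
      case False
      with True show ?thesis by (intro exI[of _ d] exI[of _ "- c"]) auto
    qed
  next
    case False
    with * show ?thesis by (intro exI[of _ b] exI[of _ "- a"]) (auto simp: algebra_simps)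
  qed
qed

section \<open>Reduction of the boundary value problem to a determinant\<close>

theorem theorem16:
  fixes A C V :: "complex^2^2"
    and a s v1 v2 v3 v4 lam :: complex
  assumes "invertible A"
    and "C = vector [vector [a, 0], vector [1, a]]"
    and "V = vector [vector [v1, v2], vector [v3, v4]]"
    and "invertible V"
    and "A = V ** C ** matrix_inv V"
    and "s^2 = a"
  shows "system_eigenvalue (B_mat C) (Psi_mat V) lam \<longleftrightarrow> EV V a s lam = 0"
proof -
  \<comment> \<open>Determinants are multiplicative, so non-singularity of \<open>A\<close> passes
    to \<open>C\<close>, whose determinant is \<open>a^2\<close>.\<close>
  have "det C \<noteq> 0"
    using assms(1,5) by (auto simp: invertible_det_nz det_mul)
  then have a: "a \<noteq> 0" by (auto simp: assms(2) det_2)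
  then have s: "s \<noteq> 0" using assms(6) by auto
  have V: "V$1$1 = v1" "V$1$2 = v2" "V$2$1 = v3" "V$2$2 = v4"
    by (simp_all add: assms(3))
  have detV: "det V = v1 * v4 - v2 * v3" by (simp add: det_2 V)
  then have D: "v1 * v4 - v2 * v3 \<noteq> 0" using assms(4) by (simp add: invertible_det_nz)
  then have nz: "v1 \<noteq> 0 \<or> v2 \<noteq> 0" "v3 \<noteq> 0 \<or> v4 \<noteq> 0" by auto
  define w h where "w = lam / s" and "h = 1 / (2 * a)"
  have B: "B_mat C lam *v y = jordan_field w h y" for y
    unfolding assms(2) w_def h_def using B_mat_jordan_block a assms(6) by blast
  show ?thesis
  \<comment> \<open>The flow formula divides by \<open>w\<close>, so the zero frequency is treated
    separately.\<close>
  proof (cases "lam = 0")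
    case True
    then have "w = 0" by (simp add: w_def)
    define y :: "complex^4" where "y = vector [v2, - v1, 0, 0]"
    have "jordan_field w h y = 0"
      by (simp add: jordan_field_def y_def \<open>w = 0\<close> vec_eq_iff forall_4 vector_4)
    moreover have "y \<noteq> 0" using nz(1) by (auto simp: y_def vec_eq_iff forall_4 vector_4)
    moreover have "Psi_mat V *v y = 0"
      by (simp add: Psi_mat_mult_eq_0_iff V y_def vector_4)
    ultimately have "system_eigenvalue (B_mat C) (Psi_mat V) lam"
      unfolding system_eigenvalue_iff B
      by (intro exI[of _ "\<lambda>_. y"]) (auto intro!: bexI[of _ 0])
    with True show ?thesis by (simp add: EV_def)
  next
    case False
    then have w: "w \<noteq> 0" using s by (simp add: w_def)
    have flow0: "jordan_flow w h 0 x = 0" for x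
      by (simp add: jordan_flow_def Let_def vec_eq_iff forall_4 vector_4)
    \<comment> \<open>A solution is the flow of its initial value \<open>y\<close>. Since the flow
      of 0 is 0, it is nontrivial exactly when \<open>y\<close> is nonzero.\<close>
    have "system_eigenvalue (B_mat C) (Psi_mat V) lam \<longleftrightarrow>
      (\<exists>y. y \<noteq> 0 \<and> Psi_mat V *v y = 0 \<and> Psi_mat V *v jordan_flow w h y 1 = 0)"
      (is "_ \<longleftrightarrow> ?flow")
    proof
      assume "system_eigenvalue (B_mat C) (Psi_mat V) lam"
      then obtain f x where f: "x \<in> {0..1}" "f x \<noteq> 0" "Psi_mat V *v f 0 = 0" "Psi_mat V *v f 1 = 0"
        "\<And>x. x \<in> {0..1} \<Longrightarrow> (f has_vector_derivative jordan_field w h (f x)) (at x within {0..1})"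
        unfolding system_eigenvalue_iff B by blast
      have "f x = jordan_flow w h (f 0) (of_real x)" if "x \<in> {0..1}" for x
        using that by (intro jordan_flow_unique[OF w, of "{0..1}"] f) auto
      from this[OF f(1)] this[of 1] f(2-4) show ?flow
        by (intro exI[of _ "f 0"]) (auto simp: flow0)
    next
      assume ?flow
      then obtain y where "y \<noteq> 0" "Psi_mat V *v y = 0" "Psi_mat V *v jordan_flow w h y 1 = 0"
        by blast
      then show "system_eigenvalue (B_mat C) (Psi_mat V) lam"
        unfolding system_eigenvalue_iff B
        by (intro exI[of _ "\<lambda>x. jordan_flow w h y (of_real x)"])
          (auto simp: jordan_flow_0 jordan_flow_has_vector_derivative[OF w] intro!: bexI[of _ 0])
    qed
    \<comment> \<open>Each half of \<open>Y m n\<close> spans the kernel of one row of the boundary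
      matrix. The factor \<open>w\<close> in the second half cancels the division by
      \<open>w\<close> in the flow.\<close>
    also define Y :: "complex \<Rightarrow> complex \<Rightarrow> complex^4" where
      "Y m n = vector [m * v2, - m * v1, w * n * v4, - w * n * v3]" for m n
    have Y0: "Y m n \<noteq> 0 \<longleftrightarrow> m \<noteq> 0 \<or> n \<noteq> 0" for m n
      using nz w by (auto simp: Y_def vec_eq_iff forall_4 vector_4)
    have YP: "Psi_mat V *v y = 0 \<longleftrightarrow> (\<exists>m n. y = Y m n)" for y
    proof -
      have "(\<exists>n. y$3 = n * v4 \<and> y$4 = - n * v3) \<longleftrightarrow> (\<exists>n. y$3 = w * n * v4 \<and> y$4 = - w * n * v3)"
        (is "?l \<longleftrightarrow> ?r")
      proof
        assume ?l
        then obtain n where "y$3 = n * v4 \<and> y$4 = - n * v3" by blast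
        then show ?r using w by (intro exI[of _ "n / w"]) auto
      next
        assume ?r
        then obtain n where "y$3 = w * n * v4 \<and> y$4 = - w * n * v3" by blast
        then show ?l by (intro exI[of _ "w * n"]) auto
      qed
      moreover have "y = Y m n \<longleftrightarrow> (y$1 = m * v2 \<and> y$2 = - m * v1) \<and> (y$3 = w * n * v4 \<and> y$4 = - w * n * v3)" for m n
        unfolding Y_def vec_eq_iff forall_4 vector_4 by blast
      ultimately show ?thesis
        unfolding Psi_mat_mult_eq_0_iff V linear_form_kernel_2[OF nz(1)] linear_form_kernel_2[OF nz(2)]
        by simp blast
    qed
    have "?flow \<longleftrightarrow> (\<exists>m n. (m \<noteq> 0 \<or> n \<noteq> 0) \<and> Psi_mat V *v jordan_flow w h (Y m n) 1 = 0)"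
      unfolding YP[of "_ :: complex^4"] using Y0 YP by metis
    \<comment> \<open>The cosine part \<open>K\<close> enters the two off-diagonal coefficients with
      opposite signs, so their product is a difference of squares.\<close>
    also define E S K where "E = (det V + v2 * v4 * h) * sin w" and "S = sin w"
      and "K = w * h * cos w"
    have "Psi_mat V *v jordan_flow w h (Y m n) 1 = 0 \<longleftrightarrow>
        v2^2 * w * h * S * m + (E - v2 * v4 * K) * n = 0 \<and>
        (E + v2 * v4 * K) * m + v4^2 * w * h * S * n = 0" for m n
    proof -
      define y where "y = jordan_flow w h (Y m n) 1"
      have y: "y$1 = m * v2 * cos w + n * v4 * sin w"
        "y$3 = w * (- m * v2 * sin w + n * v4 * cos w)"
        "y$2 = - m * v1 * cos w + n * (h * v4 - v3) * sin w - h * y$3"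
        "y$4 = w * (m * v1 * sin w + n * (h * v4 - v3) * cos w) - h * y$3 + h * w^2 * y$1"
        using w by (simp_all add: y_def jordan_flow_def Y_def Let_def vector_4 field_simps)
      have "v1 * y$1 + v2 * y$2 = v2^2 * w * h * S * m + (E - v2 * v4 * K) * n"
        unfolding y E_def S_def K_def detV by (simp add: algebra_simps power2_eq_square)
      \<comment> \<open>The common factor \<open>w\<close> is nonzero and drops out of the
        equation.\<close>
      moreover have "v3 * y$3 + v4 * y$4 = w * ((E + v2 * v4 * K) * m + v4^2 * w * h * S * n)"
        unfolding y E_def S_def K_def detV by (simp add: algebra_simps power2_eq_square)
      ultimately show ?thesis using w by (simp add: Psi_mat_mult_eq_0_iff V flip: y_def)
    qed
    then have "(\<exists>m n. (m \<noteq> 0 \<or> n \<noteq> 0) \<and> Psi_mat V *v jordan_flow w h (Y m n) 1 = 0) \<longleftrightarrow>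
      v2^2 * w * h * S * (v4^2 * w * h * S) - (E - v2 * v4 * K) * (E + v2 * v4 * K) = 0"
      by (simp only: homogeneous_system_2)
    \<comment> \<open>The sine part from the diagonal and \<open>K^2\<close> combine, since
      \<open>(w * h * S)^2 + K^2 = (w * h)^2\<close>.\<close>
    also have "v2^2 * w * h * S * (v4^2 * w * h * S) - (E - v2 * v4 * K) * (E + v2 * v4 * K) =
      v2^2 * v4^2 * (w * h)^2 - E^2"
      using sin_cos_squared_add[of w] unfolding S_def K_def by algebra
    also have "\<dots> = EV V a s lam"
    proof -
      have "(w * h)^2 = lam^2 / (4 * a^3)"
        unfolding w_def h_def using assms(6)
        by (simp add: power_mult_distrib power_divide power2_eq_square power3_eq_cube)
      then show ?thesis
        by (simp add: EV_def V E_def power_mult_distrib) (simp add: w_def h_def)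
    qed
    finally show ?thesis .
  qed
qed

end
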